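(* Suppose that the sequence $(\nu_i)_{i\in\mathbb{N}_0}$ corresponds to the numerical semigroup $\Lambda$. Then there is no other numerical semigroup with the same sequence $(\nu_i)$. That is, if two numerical semigroups have the same associated sequence $(\nu_i)_{i\in\mathbb{N}_0}$, then they are equal.
   Context: $\mathbb{N}_0$ is the set of non-negative integers. A numerical semigroup is a subset $\Lambda\subseteq\mathbb{N}_0$ containing $0$, closed under addition, with finite complement in $\mathbb{N}_0$. The enumeration of $\Lambda$ is the unique increasing bijection $\lambda:\mathbb{N}_0\to\Lambda$, written $\lambda_i=\lambda(i)$. The sequence $(\nu_i)$ corresponding to $\Lambda$ is given by $\nu_i=\#\{j\in\mathbb{N}_0\mid\lambda_i-\lambda_j\in\Lambda\}$ for $i\in\mathbb{N}_0$. *)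

theory Defs
  imports "HOL-Library.Infinite_Set"
begin

definition numerical_semigroup :: "nat set \<Rightarrow> bool" where
  "numerical_semigroup L \<longleftrightarrow>
     0 \<in> L \<and> (\<forall>x\<in>L. \<forall>y\<in>L. x + y \<in> L) \<and> finite (- L)"

text \<open>The enumeration of a numerical semigroup is the library function \<^const>\<open>enumerate\<close>;
  the lemma \<open>numerical_semigroup_enumeration_iff\<close> confirms that it is the unique increasing bijection onto the semigroup.\<close>

lemma numerical_semigroup_infinite:
  assumes "numerical_semigroup L"
  shows "infinite L"
  using assms unfolding numerical_semigroup_def
  by (metis Compl_partition finite_UnI infinite_UNIV_nat)

lemma strict_mono_range_unique:
  fixes f g :: "nat \<Rightarrow> nat"
  assumes f: "strict_mono f" and g: "strict_mono g" and eq: "range f = range g"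
  shows "f = g"
proof
  fix n
  have le: "h n \<le> k n"
    if h: "strict_mono h" and k: "strict_mono k" and r: "range h = range k"
      and IH: "\<forall>m<n. h m = k m" for h k :: "nat \<Rightarrow> nat" and n
  proof -
    have "k n \<in> range h" using r by simp
    then obtain m where m: "k n = h m" by blast
    then have "\<not> m < n" using IH k by (metis strict_mono_eq less_irrefl)
    then show ?thesis using m h by (simp add: strict_mono_less_eq)
  qed
  show "f n = g n"
  proof (induction n rule: less_induct)
    case (less n)
    then show ?case
      using le[OF f g eq, of n] le[OF g f eq[symmetric], of n] by (simp add: le_antisym)
  qed
qed

lemma numerical_semigroup_enumeration_iff:
  assumes "numerical_semigroup L"
  shows "strict_mono f \<and> bij_betw f UNIV L \<longleftrightarrow> f = enumerate L"
proof -
  have inf: "infinite L" using assms by (rule numerical_semigroup_infinite)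
  show ?thesis
    using strict_mono_range_unique[of f "enumerate L"] strict_mono_enumerate[OF inf]
      bij_enumerate[OF inf] range_enumerate[OF inf]
    by (auto simp: bij_betw_def)
qed

text \<open>The difference is taken in the integers, since subtraction on \<^typ>\<open>nat\<close> is truncated
  and \<open>0 \<in> L\<close>.\<close>

definition nu :: "nat set \<Rightarrow> nat \<Rightarrow> nat" where
  "nu L i = card {j. int (enumerate L i) - int (enumerate L j) \<in> int ` L}"

end

theory Submission
  imports Defs
begin

text \<open>
  Let \<open>g\<close> be the number of gaps of \<open>L\<close>. If \<open>n = \<lambda>\<^sub>i\<close> exceeds all gaps, then \<open>n = i + g\<close> and, by
  inclusion-exclusion, \<open>\<nu>\<^sub>i + g = i + 1 + d(n)\<close>, where \<open>d(n)\<close> is the number of ways to write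
  \<open>n\<close> as an ordered sum of two gaps. Since \<open>d(n) = 0\<close> for large \<open>n\<close>, the sequence determines \<open>g\<close>,
  and then \<open>d(n)\<close> for every \<open>n\<close> beyond the gaps. If \<open>L \<noteq> L'\<close>, let \<open>m\<close> be the largest element of the
  symmetric difference, say \<open>m \<in> L - L'\<close>, and let \<open>F\<close> be the largest gap of \<open>L'\<close>. Two gaps with
  sum \<open>F + m\<close> both lie in \<open>[m, F]\<close>, so every such pair for \<open>L\<close> is one for \<open>L'\<close>, while \<open>(m, F)\<close>
  is one for \<open>L'\<close> only.
\<close>

text \<open>An ordered pair of gaps with sum \<open>n\<close> is recorded by its first entry; the
  bound \<open>a \<le> n\<close> keeps the truncated \<open>n - a\<close> a genuine
  difference.\<close>

definition gap_sums :: "nat set \<Rightarrow> nat \<Rightarrow> nat set" where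
  "gap_sums L n = {a. a \<le> n \<and> a \<notin> L \<and> n - a \<notin> L}"

lemma finite_gap_sums [simp]: "finite (gap_sums L n)"
  by (rule finite_subset[of _ "{..n}"]) (auto simp: gap_sums_def)

text \<open>Substituting \<open>x\<close> for \<open>enumerate L j\<close> is injective and turns
  the count of indices into a count of summands.\<close>

lemma nu_eq_card_summands:
  assumes "infinite L"
  shows "nu L i = card {x \<in> L. x \<le> enumerate L i \<and> enumerate L i - x \<in> L}"
proof -
  let ?J = "{j. int (enumerate L i) - int (enumerate L j) \<in> int ` L}"
  have iff: "int a - int b \<in> int ` L \<longleftrightarrow> b \<le> a \<and> a - b \<in> L" for a b
  proof
    assume "int a - int b \<in> int ` L"
    then obtain x where "x \<in> L" "int a - int b = int x"
      by blast
    moreover from this have "a - b = x" "b \<le> a"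
      by linarith+
    ultimately show "b \<le> a \<and> a - b \<in> L"
      by simp
  next
    assume "b \<le> a \<and> a - b \<in> L"
    then show "int a - int b \<in> int ` L"
      by (metis imageI of_nat_diff)
  qed
  have img: "enumerate L ` ?J = {x \<in> L. x \<le> enumerate L i \<and> enumerate L i - x \<in> L}"
  proof (intro equalityI subsetI)
    fix x
    assume x: "x \<in> {x \<in> L. x \<le> enumerate L i \<and> enumerate L i - x \<in> L}"
    then obtain j where "x = enumerate L j"
      using range_enumerate[OF assms] by auto
    then show "x \<in> enumerate L ` ?J"
      using x by (auto simp: iff)
  qed (auto simp: iff enumerate_in_set[OF assms])
  moreover have "inj_on (enumerate L) ?J"
    by (rule strict_mono_imp_inj_on[OF strict_mono_enumerate[OF assms]])
  ultimately show ?thesis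
    unfolding nu_def by (simp add: card_image flip: img)
qed

text \<open>Below the \<open>i\<close>-th element lie exactly \<open>i\<close> elements of
  \<open>L\<close>, and everything else there is a gap; no gap is missed.\<close>

lemma enumerate_beyond_gaps:
  assumes "infinite L" and gaps: "- L \<subseteq> {..enumerate L i}"
  shows "enumerate L i = i + card (- L)"
proof -
  let ?n = "enumerate L i"
  have mono: "strict_mono (enumerate L)"
    by (rule strict_mono_enumerate[OF assms(1)])
  have mem: "?n \<in> L"
    by (rule enumerate_in_set[OF assms(1)])
  have "enumerate L ` {..<i} = {..<?n} - (- L)"
  proof (intro equalityI subsetI)
    fix x
    assume x: "x \<in> {..<?n} - (- L)"
    then obtain j where "x = enumerate L j"
      using range_enumerate[OF assms(1)] by auto
    then show "x \<in> enumerate L ` {..<i}"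
      using x strict_mono_less[OF mono] by auto
  qed (use strict_mono_less[OF mono] enumerate_in_set[OF assms(1)] in auto)
  then have "i = card ({..<?n} - (- L))"
    using card_image[OF strict_mono_imp_inj_on[OF mono], of "{..<i}"] by simp
  moreover have sub: "- L \<subseteq> {..<?n}"
    using gaps mem by (force simp: less_le)
  ultimately show ?thesis
    using card_mono[OF _ sub] card_Diff_subset[OF finite_subset[OF sub] sub] by simp
qed

text \<open>In \<open>{..n}\<close>, the summands counted by \<open>nu\<close> are what remains
  after removing the gaps and their mirror images under \<open>a \<mapsto> n - a\<close>. These two
  sets have equal size and meet in \<open>gap_sums L n\<close>.\<close>

lemma nu_beyond_gaps:
  assumes "infinite L" and gaps: "- L \<subseteq> {..enumerate L i}"
  shows "nu L i + card (- L) = i + 1 + card (gap_sums L (enumerate L i))"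
proof -
  define n where "n = enumerate L i"
  let ?B = "(\<lambda>a. n - a) ` (- L)"
  let ?R = "{x \<in> L. x \<le> n \<and> n - x \<in> L}"
  have fin: "finite (- L)"
    using gaps finite_subset by blast
  have sub: "- L \<subseteq> {..n}"
    using gaps n_def by simp
  have cardB: "card ?B = card (- L)"
    using sub by (intro card_image inj_on_inverseI[of _ "\<lambda>a. n - a"]) auto
  have B: "x \<in> ?B \<longleftrightarrow> x \<le> n \<and> n - x \<notin> L" for x
  proof
    assume "x \<in> ?B"
    then obtain a where "a \<notin> L" "x = n - a"
      by blast
    moreover from this have "a \<le> n"
      using sub by blast
    ultimately show "x \<le> n \<and> n - x \<notin> L"
      by simp
  next
    assume "x \<le> n \<and> n - x \<notin> L"
    then show "x \<in> ?B"
      by (intro image_eqI[of _ _ "n - x"]) auto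
  qed
  have "?R = {..n} - (- L \<union> ?B)"
    unfolding set_eq_iff Diff_iff Un_iff B by auto
  moreover have "- L \<union> ?B \<subseteq> {..n}"
    using sub B by (intro Un_least subsetI) (blast, simp)
  ultimately have "card ?R + card (- L \<union> ?B) = n + 1"
    using card_Diff_subset[of "- L \<union> ?B" "{..n}"] card_mono[of "{..n}" "- L \<union> ?B"]
      finite_subset[of "- L \<union> ?B" "{..n}"] by simp
  moreover have "- L \<inter> ?B = gap_sums L n"
    unfolding set_eq_iff Int_iff B by (auto simp: gap_sums_def)
  then have "card (- L) + card (- L) = card (- L \<union> ?B) + card (gap_sums L n)"
    using card_Un_Int[OF fin, of ?B] cardB fin by simp
  moreover have "nu L i = card ?R"
    using nu_eq_card_summands[OF assms(1)] n_def by simp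
  ultimately show ?thesis
    using enumerate_beyond_gaps[OF assms] n_def by simp
qed

lemma nu_eventually:
  assumes "numerical_semigroup L"
  shows "\<exists>N. \<forall>i\<ge>N. nu L i + card (- L) = i + 1"
proof -
  have inf: "infinite L"
    by (rule numerical_semigroup_infinite[OF assms])
  obtain b where b: "\<And>a. a \<notin> L \<Longrightarrow> a \<le> b"
    using assms unfolding numerical_semigroup_def finite_nat_set_iff_bounded_le by auto
  \<comment> \<open>Two gaps sum to at most \<open>2 * b\<close>, so beyond that no element is a sum
    of two gaps.\<close>
  have "nu L i + card (- L) = i + 1" if "i \<ge> 2 * b + 1" for i
  proof -
    have n: "enumerate L i \<ge> 2 * b + 1"
      using that le_enumerate[OF inf, of i] by simp
    have "- L \<subseteq> {..enumerate L i}"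
      using b n by force
    moreover have "gap_sums L (enumerate L i) = {}"
    proof -
      have False if "a \<le> enumerate L i" "a \<notin> L" "enumerate L i - a \<notin> L" for a
        using b[OF that(2)] b[OF that(3)] n by linarith
      then show ?thesis
        by (auto simp: gap_sums_def)
    qed
    ultimately show ?thesis
      using nu_beyond_gaps[OF inf] by simp
  qed
  then show ?thesis
    by blast
qed

lemma genus_eq_if_nu_eq:
  assumes "numerical_semigroup L" and "numerical_semigroup L'" and "\<And>i. nu L i = nu L' i"
  shows "card (- L) = card (- L')"
proof -
  obtain N N' where "\<forall>i\<ge>N. nu L i + card (- L) = i + 1" "\<forall>i\<ge>N'. nu L' i + card (- L') = i + 1"
    using nu_eventually assms(1,2) by meson
  from this(1)[rule_format, of "max N N'"] this(2)[rule_format, of "max N N'"] show ?thesis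
    using assms(3)[of "max N N'"] by simp
qed

text \<open>Equal genus gives \<open>n\<close> the same index in both enumerations, so the two
  values of \<open>nu\<close> at that index can be compared.\<close>

lemma card_gap_sums_eq_if_nu_eq:
  assumes L: "numerical_semigroup L" and L': "numerical_semigroup L'"
    and nu: "\<And>i. nu L i = nu L' i"
    and n: "- L \<subseteq> {..<n}" "- L' \<subseteq> {..<n}"
  shows "card (gap_sums L n) = card (gap_sums L' n)"
proof -
  note inf = numerical_semigroup_infinite[OF L] numerical_semigroup_infinite[OF L']
  have "n \<in> L" "n \<in> L'"
    using n by auto
  then obtain i j where i: "enumerate L i = n" and j: "enumerate L' j = n"
    using enumerate_Ex inf by meson
  have gaps: "- L \<subseteq> {..enumerate L i}" "- L' \<subseteq> {..enumerate L' j}"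
    using n unfolding i j by auto
  have g: "card (- L) = card (- L')"
    by (rule genus_eq_if_nu_eq[OF L L' nu])
  have "i = j"
    using enumerate_beyond_gaps[OF inf(1) gaps(1)] enumerate_beyond_gaps[OF inf(2) gaps(2)] g i j
    by simp
  then show ?thesis
    using nu_beyond_gaps[OF inf(1) gaps(1)] nu_beyond_gaps[OF inf(2) gaps(2)] g nu[of i] i j
    by simp
qed

lemma nu_separates:
  assumes L: "numerical_semigroup L" and L': "numerical_semigroup L'"
    and nu: "\<And>i. nu L i = nu L' i"
    and m: "m \<in> L" "m \<notin> L'" and above: "\<And>x. x > m \<Longrightarrow> x \<in> L \<longleftrightarrow> x \<in> L'"
  shows False
proof -
  have "0 \<in> L'" and fin: "finite (- L')"
    using L' by (auto simp: numerical_semigroup_def)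
  \<comment> \<open>Positivity puts \<open>F + m\<close> strictly above every gap, where the counts
    of gap sums must agree.\<close>
  then have "m > 0"
    using m by (metis gr0I)
  define F where "F = Max (- L')"
  have F: "F \<notin> L'"
    using Max_in[OF fin] m F_def by auto
  have le': "a \<le> F" if "a \<notin> L'" for a
    using Max_ge[OF fin] that F_def by simp
  \<comment> \<open>A gap of \<open>L\<close> above \<open>m\<close> is also a gap of
    \<open>L'\<close>; any other is at most \<open>m\<close>, itself a gap of
    \<open>L'\<close>.\<close>
  have le: "a \<le> F" if "a \<notin> L" for a
    using le'[of a] le'[OF m(2)] above[of a] that by (cases "a > m") auto
  have "gap_sums L (F + m) \<subseteq> gap_sums L' (F + m)"
  proof
    fix a
    assume "a \<in> gap_sums L (F + m)"
    then have a: "a \<le> F + m" "a \<notin> L" "F + m - a \<notin> L"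
      by (auto simp: gap_sums_def)
    \<comment> \<open>Each summand is at least \<open>m\<close> because the other is at most
      \<open>F\<close>; equality fails since \<open>m\<close> is not a gap of
      \<open>L\<close>.\<close>
    have "a \<noteq> m" "F + m - a \<noteq> m"
      using a m(1) by auto
    then have "a > m" "F + m - a > m"
      using a(1) le[OF a(2)] le[OF a(3)] by linarith+
    then show "a \<in> gap_sums L' (F + m)"
      using a above by (simp add: gap_sums_def)
  qed
  moreover have "m \<in> gap_sums L' (F + m)" "m \<notin> gap_sums L (F + m)"
    using m F by (auto simp: gap_sums_def)
  ultimately have "card (gap_sums L (F + m)) < card (gap_sums L' (F + m))"
    by (intro psubset_card_mono) auto
  moreover have "card (gap_sums L (F + m)) = card (gap_sums L' (F + m))"
    using le le' \<open>m > 0\<close> by (intro card_gap_sums_eq_if_nu_eq[OF L L' nu]) force+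
  ultimately show False
    by simp
qed

theorem theorem8p1:
  fixes L L' :: "nat set"
  assumes "numerical_semigroup L"
    and "numerical_semigroup L'"
    and "\<forall>i. nu L i = nu L' i"
  shows "L = L'"
proof (rule ccontr)
  assume "L \<noteq> L'"
  define D where "D = (L - L') \<union> (L' - L)"
  have "D \<subseteq> - L \<union> - L'"
    by (auto simp: D_def)
  then have fin: "finite D"
    using assms(1,2) by (meson finite_UnI finite_subset numerical_semigroup_def)
  have "D \<noteq> {}"
    using \<open>L \<noteq> L'\<close> by (auto simp: D_def)
  define m where "m = Max D"
  have "m \<in> D"
    using Max_in[OF fin \<open>D \<noteq> {}\<close>] m_def by simp
  have above: "x \<in> L \<longleftrightarrow> x \<in> L'" if "x > m" for x
    using Max_ge[OF fin, of x] that by (auto simp: D_def m_def)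
  \<comment> \<open>The two cases for \<open>m\<close> differ only by exchanging \<open>L\<close>
    and \<open>L'\<close>.\<close>
  show False
    using \<open>m \<in> D\<close> nu_separates[of L L' m] nu_separates[of L' L m] assms above
    by (auto simp: D_def)
qed

end
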